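(* Let $X$ be a measurable space, $Y=\{-1,1\}$, $\mathcal{H}$ a real Hilbert space and $\phi:X\to\mathcal{H}$ a bounded feature map. For every probability distribution $P$ on $X\times Y$ and every $\sigma\in[0,\frac12)$, $$\mathrm{Risk}_{01}(P,\Phi(P))=\mathrm{Risk}_{01}(P,\Phi(P_\sigma)).$$
   Context: A bounded feature map is a (strongly) measurable map $\phi:X\to\mathcal{H}$ with $\|\phi(x)\|\le1$ for all $x$. For a distribution $P$ on $X\times Y$, the mean vector is $\Phi(P)=\mathbb{E}_{(x,y)\sim P}\,y\,\phi(x)\in\mathcal{H}$. $P_\sigma$ is the distribution obtained by drawing $(x,y)\sim P$ and then independently flipping the label $y$ to $-y$ with probability $\sigma$. For $\omega\in\mathcal{H}$, $\mathrm{Risk}_{01}(P,\omega)=\mathbb{E}_{(x,y)\sim P}\,\ell_{01}(y,\langle\omega,\phi(x)\rangle)$, where $\ell_{01}(y,v)=1$ if $yv\le0$ and $0$ otherwise. *)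

theory Defs
  imports "HOL-Probability.Probability"
begin

text \<open>
  The library's Bochner integral is restricted to second-countable codomains. Here the Hilbert
  space is arbitrary, so the same construction is repeated with Borel measurability replaced by
  strong measurability. The lemmas below show that nothing changes for second-countable spaces.
\<close>

definition strongly_measurable :: "'a measure \<Rightarrow> ('a \<Rightarrow> 'b::metric_space) \<Rightarrow> bool" where
  "strongly_measurable M f \<longleftrightarrow>
     (\<exists>s. (\<forall>i::nat. simple_function M (s i)) \<and> (\<forall>x\<in>space M. (\<lambda>i. s i x) \<longlonglongrightarrow> f x))"

definition has_strong_bochner_integral ::
    "'a measure \<Rightarrow> ('a \<Rightarrow> 'b::real_normed_vector) \<Rightarrow> 'b \<Rightarrow> bool" where
  "has_strong_bochner_integral M f I \<longleftrightarrow>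
     strongly_measurable M f \<and>
     (\<exists>s. (\<forall>i::nat. Bochner_Integration.simple_bochner_integrable M (s i)) \<and>
          (\<lambda>i. \<integral>\<^sup>+x. norm (f x - s i x) \<partial>M) \<longlonglongrightarrow> 0 \<and>
          (\<lambda>i. Bochner_Integration.simple_bochner_integral M (s i)) \<longlonglongrightarrow> I)"

definition strong_bochner_integral :: "'a measure \<Rightarrow> ('a \<Rightarrow> 'b::banach) \<Rightarrow> 'b" where
  "strong_bochner_integral M f =
     (if \<exists>I. has_strong_bochner_integral M f I
      then THE I. has_strong_bochner_integral M f I else 0)"

lemma strongly_measurable_iff_borel_measurable:
  fixes f :: "'a \<Rightarrow> 'b::{metric_space, second_countable_topology}"
  shows "strongly_measurable M f \<longleftrightarrow> f \<in> borel_measurable M"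
proof
  assume "strongly_measurable M f"
  then obtain s where s: "\<And>i::nat. simple_function M (s i)"
      "\<And>x. x \<in> space M \<Longrightarrow> (\<lambda>i. s i x) \<longlonglongrightarrow> f x"
    unfolding strongly_measurable_def by blast
  show "f \<in> borel_measurable M"
    by (rule borel_measurable_LIMSEQ_metric[where f = s])
      (auto intro: borel_measurable_simple_function s)
next
  assume "f \<in> borel_measurable M"
  from borel_measurable_implies_sequence_metric[OF this]
  show "strongly_measurable M f"
    unfolding strongly_measurable_def by blast
qed

lemma has_strong_bochner_integral_iff:
  fixes f :: "'a \<Rightarrow> 'b::{real_normed_vector, second_countable_topology}"
  shows "has_strong_bochner_integral M f I \<longleftrightarrow> has_bochner_integral M f I"
  unfolding has_strong_bochner_integral_def has_bochner_integral.simps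
    strongly_measurable_iff_borel_measurable
  by blast

lemma strong_bochner_integral_eq_lebesgue_integral:
  fixes f :: "'a \<Rightarrow> 'b::{banach, second_countable_topology}"
  shows "strong_bochner_integral M f = integral\<^sup>L M f"
  unfolding strong_bochner_integral_def lebesgue_integral_def has_strong_bochner_integral_iff ..

definition bounded_feature_map :: "'x measure \<Rightarrow> ('x \<Rightarrow> 'h::real_normed_vector) \<Rightarrow> bool" where
  "bounded_feature_map X \<phi> \<longleftrightarrow> strongly_measurable X \<phi> \<and> (\<forall>x\<in>space X. norm (\<phi> x) \<le> 1)"

definition labels :: "real measure" where
  "labels = count_space {-1, 1}"

definition mean_vector :: "('x \<Rightarrow> 'h::banach) \<Rightarrow> ('x \<times> real) measure \<Rightarrow> 'h" where
  "mean_vector \<phi> P = strong_bochner_integral P (\<lambda>(x, y). y *\<^sub>R \<phi> x)"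

definition flip_labels :: "real \<Rightarrow> ('x \<times> real) measure \<Rightarrow> ('x \<times> real) measure" where
  "flip_labels \<sigma> P =
     distr (P \<Otimes>\<^sub>M measure_pmf (bernoulli_pmf \<sigma>)) P
       (\<lambda>((x, y), flip). (x, if flip then - y else y))"

definition zero_one_loss :: "real \<Rightarrow> real \<Rightarrow> real" where
  "zero_one_loss y v = (if y * v \<le> 0 then 1 else 0)"

definition zero_one_risk ::
    "('x \<Rightarrow> 'h::real_inner) \<Rightarrow> ('x \<times> real) measure \<Rightarrow> 'h \<Rightarrow> real" where
  "zero_one_risk \<phi> P \<omega> = (\<integral>(x, y). zero_one_loss y (inner \<omega> (\<phi> x)) \<partial>P)"

end

theory Submission
  imports Defs
begin

text \<open>
  Flipping a label with probability \<open>\<sigma>\<close> multiplies its conditional mean by \<open>1 - 2 * \<sigma>\<close>, so the two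
  mean vectors differ by this positive factor, to which the zero-one loss is insensitive. Since the
  Hilbert space need not be separable, the identity of the mean vectors is tested against an
  arbitrary vector \<open>h\<close>: strong Bochner integrals commute with bounded linear maps, which reduces it
  to Fubini for real-valued integrals. This argument needs the mean vectors to exist, that is, strong
  Bochner integrability of bounded strongly measurable functions on finite measure spaces.
\<close>

section \<open>Strong measurability\<close>

lemma strongly_measurable_cong_sets:
  assumes "sets M = sets N"
  shows "strongly_measurable M f \<longleftrightarrow> strongly_measurable N f"
  using sets_eq_imp_space_eq[OF assms]
  by (simp add: strongly_measurable_def simple_function_def assms)

text \<open>Precomposing the simple approximants with \<open>T\<close> keeps their ranges finite.
  This serves to pull the feature map back along \<open>fst\<close>.\<close>

lemma strongly_measurable_comp:
  assumes "strongly_measurable N f" "T \<in> measurable M N"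
  shows "strongly_measurable M (\<lambda>x. f (T x))"
proof -
  obtain s where s: "\<And>i::nat. simple_function N (s i)"
      "\<And>x. x \<in> space N \<Longrightarrow> (\<lambda>i. s i x) \<longlonglongrightarrow> f x"
    using assms(1) unfolding strongly_measurable_def by blast
  have "simple_function M (\<lambda>x. s i (T x))" for i
  proof -
    have "s i \<in> measurable N (count_space UNIV)" "finite (s i ` space N)"
      using s(1)[of i] by (auto simp: simple_function_eq_measurable)
    moreover have "(\<lambda>x. s i (T x)) ` space M \<subseteq> s i ` space N"
      using measurable_space[OF assms(2)] by auto
    ultimately show ?thesis
      using assms(2) by (auto simp: simple_function_eq_measurable intro: finite_subset)
  qed
  moreover have "(\<lambda>i. s i (T x)) \<longlonglongrightarrow> f (T x)" if "x \<in> space M" for x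
    using s(2) measurable_space[OF assms(2) that] by blast
  ultimately show ?thesis
    unfolding strongly_measurable_def by (intro exI[of _ "\<lambda>i x. s i (T x)"]) blast
qed

text \<open>Joint continuity carries the limit through pairs of simple approximants. Arguing with
  sequences avoids the Borel sets of a product space, which can exceed the product sigma-algebra
  when the factors are not separable.\<close>

lemma strongly_measurable_continuous_comp2:
  assumes "strongly_measurable M f" "strongly_measurable M g"
    and h: "continuous_on UNIV (\<lambda>z. h (fst z) (snd z))"
  shows "strongly_measurable M (\<lambda>x. h (f x) (g x))"
proof -
  obtain s t where s: "\<And>i::nat. simple_function M (s i)" "\<And>x. x \<in> space M \<Longrightarrow> (\<lambda>i. s i x) \<longlonglongrightarrow> f x"
    and t: "\<And>i::nat. simple_function M (t i)" "\<And>x. x \<in> space M \<Longrightarrow> (\<lambda>i. t i x) \<longlonglongrightarrow> g x"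
    using assms(1,2) unfolding strongly_measurable_def by blast
  have "(\<lambda>i. h (s i x) (t i x)) \<longlonglongrightarrow> h (f x) (g x)" if "x \<in> space M" for x
    using continuous_on_tendsto_compose[OF h tendsto_Pair[OF s(2)[OF that] t(2)[OF that]]]
    by simp
  then show ?thesis
    unfolding strongly_measurable_def
    by (intro exI[of _ "\<lambda>i x. h (s i x) (t i x)"])
      (auto intro: simple_function_compose2[OF s(1) t(1)])
qed

lemma strongly_measurable_continuous_comp:
  assumes "strongly_measurable M f" "continuous_on UNIV h"
  shows "strongly_measurable M (\<lambda>x. h (f x))"
  by (rule strongly_measurable_continuous_comp2[OF assms(1,1)])
    (rule continuous_on_compose2[OF assms(2)], auto intro: continuous_intros)

lemma strongly_measurable_simple_function:
  "simple_function M f \<Longrightarrow> strongly_measurable M f"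
  unfolding strongly_measurable_def by (intro exI[of _ "\<lambda>_. f"]) auto

text \<open>Norms are real-valued, so strong measurability turns back into Borel measurability, as
  calculations with nonnegative integrals require.\<close>

lemma strongly_measurable_norm_diff:
  fixes f g :: "'a \<Rightarrow> 'b::real_normed_vector"
  assumes "strongly_measurable M f" "strongly_measurable M g"
  shows "(\<lambda>x. norm (f x - g x)) \<in> borel_measurable M"
  unfolding strongly_measurable_iff_borel_measurable[symmetric]
  by (rule strongly_measurable_continuous_comp2[OF assms]) (intro continuous_intros)

section \<open>Strong Bochner integrals\<close>

text \<open>\<open>T\<close> maps simple approximants to simple approximants, enlarges the L1 error
  by at most a constant factor, and commutes with simple integrals and with their limit.\<close>

lemma has_strong_bochner_integral_bounded_linear:
  assumes T: "bounded_linear T" and f: "has_strong_bochner_integral M f I"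
  shows "has_strong_bochner_integral M (\<lambda>x. T (f x)) (T I)"
proof -
  interpret T: bounded_linear T by fact
  obtain s where f_sm: "strongly_measurable M f"
    and s: "\<And>i::nat. Bochner_Integration.simple_bochner_integrable M (s i)"
    and lim: "(\<lambda>i. \<integral>\<^sup>+x. norm (f x - s i x) \<partial>M) \<longlonglongrightarrow> 0"
    and int: "(\<lambda>i. Bochner_Integration.simple_bochner_integral M (s i)) \<longlonglongrightarrow> I"
    using f unfolding has_strong_bochner_integral_def by blast
  obtain K where K: "K > 0" "\<And>x. norm (T x) \<le> norm x * K"
    using T.pos_bounded by blast
  have bound: "(\<integral>\<^sup>+x. norm (T (f x) - T (s i x)) \<partial>M) \<le> K * (\<integral>\<^sup>+x. norm (f x - s i x) \<partial>M)" for i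
  proof -
    have [measurable]: "(\<lambda>x. norm (f x - s i x)) \<in> borel_measurable M"
      using s[of i]
      by (intro strongly_measurable_norm_diff f_sm strongly_measurable_simple_function)
        (auto elim: Bochner_Integration.simple_bochner_integrable.cases)
    have "(\<integral>\<^sup>+x. norm (T (f x) - T (s i x)) \<partial>M) \<le> (\<integral>\<^sup>+x. ennreal K * norm (f x - s i x) \<partial>M)"
      using K by (intro nn_integral_mono)
        (auto simp: T.diff[symmetric] mult.commute simp flip: ennreal_mult)
    also have "\<dots> = K * (\<integral>\<^sup>+x. norm (f x - s i x) \<partial>M)"
      by (rule nn_integral_cmult) simp
    finally show ?thesis .
  qed
  have "(\<lambda>i. \<integral>\<^sup>+x. norm (T (f x) - T (s i x)) \<partial>M) \<longlonglongrightarrow> 0"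
  proof (rule tendsto_sandwich[OF _ _ tendsto_const])
    show "(\<lambda>i. K * (\<integral>\<^sup>+x. norm (f x - s i x) \<partial>M)) \<longlonglongrightarrow> 0"
      using ennreal_tendsto_cmult[OF _ lim, of "ennreal K"] by simp
  qed (use bound in auto)
  \<comment> \<open>Since \<open>T 0 = 0\<close>, the set where \<open>T (s i x)\<close> is nonzero
    still has finite measure.\<close>
  moreover have "Bochner_Integration.simple_bochner_integrable M (\<lambda>x. T (s i x))" for i
    by (rule Bochner_Integration.simple_bochner_integrable_compose2[OF _ s s, of "\<lambda>x _. T x"])
      (simp add: T.zero)
  moreover have "(\<lambda>i. Bochner_Integration.simple_bochner_integral M (\<lambda>x. T (s i x))) \<longlonglongrightarrow> T I"
    using T.tendsto[OF int]
    by (simp add: Bochner_Integration.simple_bochner_integral_linear[OF T.linear s])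
  ultimately show ?thesis
    unfolding has_strong_bochner_integral_def
    using strongly_measurable_continuous_comp[OF f_sm T.continuous_on[OF continuous_on_id]]
    by (intro conjI exI[of _ "\<lambda>i x. T (s i x)"]) auto
qed

lemma has_strong_bochner_integral_inner:
  assumes "has_strong_bochner_integral M f I"
  shows "has_bochner_integral M (\<lambda>x. inner h (f x)) (inner h I)"
  using has_strong_bochner_integral_bounded_linear[OF bounded_linear_inner_right assms]
  by (simp add: has_strong_bochner_integral_iff)

text \<open>Two candidate values have the same inner product with every vector, by uniqueness of
  real-valued integrals, hence coincide.\<close>

lemma has_strong_bochner_integral_unique:
  fixes f :: "'a \<Rightarrow> 'b::real_inner"
  assumes "has_strong_bochner_integral M f I" "has_strong_bochner_integral M f J"
  shows "I = J"
  using assms[THEN has_strong_bochner_integral_inner] has_bochner_integral_eq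
  by (metis vector_eq_rdot inner_commute)

lemma strong_bochner_integral_eqI:
  fixes f :: "'a \<Rightarrow> 'b::{real_inner, banach}"
  assumes "has_strong_bochner_integral M f I"
  shows "strong_bochner_integral M f = I"
proof -
  have "(THE I. has_strong_bochner_integral M f I) = I"
    using assms by (rule the_equality) (rule has_strong_bochner_integral_unique[OF _ assms])
  moreover have "\<exists>I. has_strong_bochner_integral M f I"
    using assms by (rule exI)
  ultimately show ?thesis
    by (simp only: strong_bochner_integral_def if_True)
qed

text \<open>The simple integrals are no further apart than \<open>s\<close> and \<open>t\<close> are
  in L1, and the triangle inequality through \<open>f\<close> bounds that distance. This yields the
  Cauchy property of approximating integrals.\<close>

lemma norm_simple_bochner_integral_diff_le:
  fixes f s t :: "'a \<Rightarrow> 'b::real_normed_vector"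
  assumes f: "strongly_measurable M f"
    and s: "Bochner_Integration.simple_bochner_integrable M s"
    and t: "Bochner_Integration.simple_bochner_integrable M t"
  shows "ennreal (norm (Bochner_Integration.simple_bochner_integral M s
            - Bochner_Integration.simple_bochner_integral M t))
          \<le> (\<integral>\<^sup>+x. norm (f x - s x) \<partial>M) + (\<integral>\<^sup>+x. norm (f x - t x) \<partial>M)"
proof -
  have [measurable]: "(\<lambda>x. norm (f x - s x)) \<in> borel_measurable M"
      "(\<lambda>x. norm (f x - t x)) \<in> borel_measurable M"
    using s t
    by (auto intro!: strongly_measurable_norm_diff f strongly_measurable_simple_function
        elim: Bochner_Integration.simple_bochner_integrable.cases)
  have "ennreal (norm (Bochner_Integration.simple_bochner_integral M s
            - Bochner_Integration.simple_bochner_integral M t))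
      \<le> Bochner_Integration.simple_bochner_integral M (\<lambda>x. norm (s x - t x))"
    unfolding Bochner_Integration.simple_bochner_integral_diff[OF s t, symmetric]
    by (intro ennreal_leI Bochner_Integration.simple_bochner_integral_norm_bound
        Bochner_Integration.simple_bochner_integrable_compose2[OF _ s t]) simp
  also have "\<dots> = (\<integral>\<^sup>+x. norm (s x - t x) \<partial>M)"
    by (intro Bochner_Integration.simple_bochner_integral_eq_nn_integral
        Bochner_Integration.simple_bochner_integrable_compose2[OF _ s t, of "\<lambda>x y. norm (x - y)"]) auto
  also have "\<dots> \<le> (\<integral>\<^sup>+x. ennreal (norm (f x - s x)) + ennreal (norm (f x - t x)) \<partial>M)"
  proof (intro nn_integral_mono)
    fix x
    have "norm (s x - t x) \<le> norm (f x - s x) + norm (f x - t x)"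
      by (metis norm_diff_triangle_le norm_minus_commute order_refl)
    then show "ennreal (norm (s x - t x)) \<le> ennreal (norm (f x - s x)) + ennreal (norm (f x - t x))"
      by (simp flip: ennreal_plus)
  qed
  also have "\<dots> = (\<integral>\<^sup>+x. norm (f x - s x) \<partial>M) + (\<integral>\<^sup>+x. norm (f x - t x) \<partial>M)"
    by (rule nn_integral_add) auto
  finally show ?thesis .
qed

text \<open>L1 approximation alone suffices: the simple integrals are Cauchy, and completeness
  supplies their limit.\<close>

lemma has_strong_bochner_integralI:
  fixes f :: "'a \<Rightarrow> 'b::banach"
  assumes f: "strongly_measurable M f"
    and s: "\<And>i::nat. Bochner_Integration.simple_bochner_integrable M (s i)"
    and lim: "(\<lambda>i. \<integral>\<^sup>+x. norm (f x - s i x) \<partial>M) \<longlonglongrightarrow> 0"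
  shows "\<exists>I. has_strong_bochner_integral M f I"
proof -
  let ?I = "\<lambda>i. Bochner_Integration.simple_bochner_integral M (s i)"
  have "Cauchy ?I"
  proof (rule metric_CauchyI)
    fix e :: real assume "0 < e"
    \<comment> \<open>Two errors below \<open>e / 3\<close> add up to at most
      \<open>2 * e / 3\<close>, which leaves room for the strict inequality.\<close>
    then have "0 < ennreal (e / 3)" by simp
    from order_tendstoD(2)[OF lim this]
    obtain N where N: "\<And>n. n \<ge> N \<Longrightarrow> (\<integral>\<^sup>+x. norm (f x - s n x) \<partial>M) < ennreal (e / 3)"
      by (auto simp: eventually_sequentially)
    have "dist (?I m) (?I n) < e" if "m \<ge> N" "n \<ge> N" for m n
    proof -
      have "ennreal (dist (?I m) (?I n)) \<le> ennreal (e / 3) + ennreal (e / 3)"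
        unfolding dist_norm
        by (rule order_trans[OF norm_simple_bochner_integral_diff_le[OF f s s]])
          (intro add_mono less_imp_le N that)
      then show ?thesis
        using \<open>0 < e\<close> by (simp add: ennreal_le_iff flip: ennreal_plus)
    qed
    then show "\<exists>N. \<forall>m\<ge>N. \<forall>n\<ge>N. dist (?I m) (?I n) < e" by blast
  qed
  then obtain I where "?I \<longlonglongrightarrow> I"
    using Cauchy_convergent convergent_def by blast
  then show ?thesis
    using assms unfolding has_strong_bochner_integral_def by blast
qed

text \<open>Dominated convergence gives L1 approximation: on a finite measure space constants are
  integrable and can serve as the dominating function.\<close>

lemma (in finite_measure) strong_bochner_integrable_bounded:
  fixes f :: "'a \<Rightarrow> 'b::banach"
  assumes f: "strongly_measurable M f" and B: "\<And>x. x \<in> space M \<Longrightarrow> norm (f x) \<le> B"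
  shows "\<exists>I. has_strong_bochner_integral M f I"
proof -
  obtain s where s: "\<And>i::nat. simple_function M (s i)"
      "\<And>x. x \<in> space M \<Longrightarrow> (\<lambda>i. s i x) \<longlonglongrightarrow> f x"
    using f unfolding strongly_measurable_def by blast
  \<comment> \<open>Truncation dominates the approximants; as the threshold exceeds the bound on \<open>f\<close>, it does not
    disturb pointwise convergence.\<close>
  define t where "t i x = (if norm (s i x) \<le> B + 1 then s i x else 0)" for i x
  have t_sf: "simple_function M (t i)" for i
    unfolding t_def by (rule simple_function_compose1[OF s(1)])
  have t_lim: "(\<lambda>i. t i x) \<longlonglongrightarrow> f x" if x: "x \<in> space M" for x
  proof (rule Lim_transform_eventually[OF s(2)[OF x]])
    have "norm (f x) < B + 1" using B[OF x] by simp
    from order_tendstoD(2)[OF tendsto_norm[OF s(2)[OF x]] this]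
    show "\<forall>\<^sub>F i in sequentially. s i x = t i x"
      by eventually_elim (simp add: t_def)
  qed
  have t_sbi: "Bochner_Integration.simple_bochner_integrable M (t i)" for i
    by (intro Bochner_Integration.simple_bochner_integrable.intros t_sf) simp
  have bound: "norm (f x - t i x) \<le> 2 * \<bar>B\<bar> + 1" if x: "x \<in> space M" for i x
  proof -
    have "norm (t i x) \<le> \<bar>B\<bar> + 1" by (auto simp: t_def)
    then show ?thesis using norm_triangle_ineq4[of "f x" "t i x"] B[OF x] by linarith
  qed
  \<comment> \<open>Dominated convergence is applied to the real-valued errors with limit function
    0, because it asks for a second-countable codomain. Hence the form
    \<open>0 - norm ...\<close>.\<close>
  have "(\<lambda>i. \<integral>\<^sup>+x. norm (0 - norm (f x - t i x)) \<partial>M) \<longlonglongrightarrow> 0"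
  proof (rule nn_integral_dominated_convergence_norm[where w = "\<lambda>_. 2 * \<bar>B\<bar> + 1"])
    show "(\<lambda>x. norm (f x - t i x)) \<in> borel_measurable M" for i
      by (intro strongly_measurable_norm_diff f strongly_measurable_simple_function t_sf)
    show "(\<integral>\<^sup>+x. ennreal (2 * \<bar>B\<bar> + 1) \<partial>M) < \<infinity>"
      by (simp add: ennreal_mult_eq_top_iff less_top[symmetric])
    have "(\<lambda>i. norm (f x - t i x)) \<longlonglongrightarrow> 0" if "x \<in> space M" for x
      using tendsto_norm[OF tendsto_diff[OF tendsto_const t_lim[OF that], of "f x"]] by simp
    then show "AE x in M. (\<lambda>i. norm (f x - t i x)) \<longlonglongrightarrow> 0" by simp
  qed (use bound in auto)
  then show ?thesis
    by (intro has_strong_bochner_integralI[OF f t_sbi]) simp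
qed

section \<open>Label noise\<close>

lemma measurable_flip_labels:
  assumes P: "sets P = sets (X \<Otimes>\<^sub>M labels)"
  shows "(\<lambda>((x, y), flip). (x, if flip then - y else y))
    \<in> measurable (P \<Otimes>\<^sub>M measure_pmf (bernoulli_pmf \<sigma>)) P"
proof -
  have [measurable]: "uminus \<in> measurable labels labels"
    by (auto simp: labels_def)
  have "(\<lambda>z. (fst (fst z), if snd z then - snd (fst z) else snd (fst z)))
      \<in> measurable ((X \<Otimes>\<^sub>M labels) \<Otimes>\<^sub>M count_space UNIV) (X \<Otimes>\<^sub>M labels)"
    by measurable
  moreover have "sets (P \<Otimes>\<^sub>M measure_pmf (bernoulli_pmf \<sigma>))
      = sets ((X \<Otimes>\<^sub>M labels) \<Otimes>\<^sub>M count_space UNIV)"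
    by (intro sets_pair_measure_cong P) simp
  ultimately show ?thesis
    by (simp add: case_prod_beta' measurable_cong_sets[OF _ P])
qed

text \<open>Fubini with the coin as inner variable: for fixed \<open>(x, y)\<close> the integral
  over the coin is a sum of two terms. Boundedness of \<open>g\<close> gives integrability on the
  product.\<close>

lemma integral_flip_labels:
  fixes g :: "'x \<times> real \<Rightarrow> 'b::{banach, second_countable_topology}"
  assumes "prob_space P" and P: "sets P = sets (X \<Otimes>\<^sub>M labels)" and \<sigma>: "0 \<le> \<sigma>" "\<sigma> \<le> 1"
    and g: "g \<in> borel_measurable P" and B: "\<And>z. z \<in> space P \<Longrightarrow> norm (g z) \<le> B"
  shows "integral\<^sup>L (flip_labels \<sigma> P) g
    = (\<integral>(x, y). \<sigma> *\<^sub>R g (x, - y) + (1 - \<sigma>) *\<^sub>R g (x, y) \<partial>P)"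
proof -
  interpret P: prob_space P by fact
  interpret B: prob_space "measure_pmf (bernoulli_pmf \<sigma>)" by (rule prob_space_measure_pmf)
  interpret PB: pair_prob_space P "measure_pmf (bernoulli_pmf \<sigma>)" ..
  let ?k = "\<lambda>((x, y), flip). (x, if flip then - y else y) :: 'x \<times> real"
  note k = measurable_flip_labels[OF P, of \<sigma>]
  have "integrable (P \<Otimes>\<^sub>M measure_pmf (bernoulli_pmf \<sigma>)) (\<lambda>z. g (?k z))"
    using B measurable_space[OF k]
    by (intro PB.integrable_const_bound[where B = B] measurable_compose[OF k g]) auto
  from PB.integral_fst'[OF this]
  show ?thesis
    unfolding flip_labels_def integral_distr[OF k g] using \<sigma>
    by (simp add: case_prod_beta' integral_measure_pmf[of UNIV] UNIV_bool add.commute)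
qed

lemma mean_vector_flip_labels:
  fixes \<phi> :: "'x \<Rightarrow> 'h::{real_inner, banach}"
  assumes \<phi>: "bounded_feature_map X \<phi>"
    and "prob_space P" and P: "sets P = sets (X \<Otimes>\<^sub>M labels)"
    and \<sigma>: "0 \<le> \<sigma>" "\<sigma> \<le> 1"
  shows "mean_vector \<phi> (flip_labels \<sigma> P) = (1 - 2 * \<sigma>) *\<^sub>R mean_vector \<phi> P"
proof -
  interpret P: prob_space P by fact
  interpret B: prob_space "measure_pmf (bernoulli_pmf \<sigma>)" by (rule prob_space_measure_pmf)
  interpret PB: pair_prob_space P "measure_pmf (bernoulli_pmf \<sigma>)" ..
  let ?Q = "flip_labels \<sigma> P" and ?f = "\<lambda>(x, y). y *\<^sub>R \<phi> x"
  \<comment> \<open>The noisy distribution lives on the sigma-algebra of \<open>P\<close>, so the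
    measurability and the bound of \<open>?f\<close> transfer to it.\<close>
  have Q: "sets ?Q = sets P" by (simp add: flip_labels_def)
  interpret Q: prob_space ?Q
    unfolding flip_labels_def by (rule PB.prob_space_distr[OF measurable_flip_labels[OF P]])
  have space: "space P = space X \<times> {- 1, 1}"
    using sets_eq_imp_space_eq[OF P] by (simp add: space_pair_measure labels_def)
  have bound: "norm (?f z) \<le> 1" if "z \<in> space P" for z
    using that \<phi> by (auto simp: space bounded_feature_map_def)
  have "fst \<in> measurable P X" "snd \<in> borel_measurable P"
    by (auto simp: measurable_cong_sets[OF P refl] labels_def
        intro: measurable_compose[OF measurable_snd])
  then have f: "strongly_measurable P ?f"
    unfolding case_prod_beta' using \<phi>
    by (intro strongly_measurable_continuous_comp2[where h = "(*\<^sub>R)"])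
      (auto simp: strongly_measurable_iff_borel_measurable bounded_feature_map_def
        intro: strongly_measurable_comp intro!: continuous_intros)
  obtain I where I: "has_strong_bochner_integral P ?f I"
    using P.strong_bochner_integrable_bounded[OF f bound] by blast
  obtain J where J: "has_strong_bochner_integral ?Q ?f J"
    using Q.strong_bochner_integrable_bounded[of ?f 1] f bound
    by (auto simp: strongly_measurable_cong_sets[OF Q] sets_eq_imp_space_eq[OF Q])
  have "inner h J = inner h ((1 - 2 * \<sigma>) *\<^sub>R I)" for h
  proof -
    note Ih = has_strong_bochner_integral_inner[OF I, of h]
    \<comment> \<open>Cauchy-Schwarz supplies the boundedness that
      \<open>integral_flip_labels\<close> demands.\<close>
    have "norm (inner h (?f z)) \<le> norm h" if "z \<in> space P" for z
      using Cauchy_Schwarz_ineq2[of h "?f z"] mult_left_mono[OF bound[OF that], of "norm h"] by simp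
    note flip = integral_flip_labels[OF \<open>prob_space P\<close> P \<sigma>
        borel_measurable_has_bochner_integral[OF Ih] this]
    have "inner h J = (\<integral>z. inner h (?f z) \<partial>?Q)"
      using has_strong_bochner_integral_inner[OF J] by (rule has_bochner_integral_integral_eq[symmetric])
    also have "\<dots> = (\<integral>(x, y). \<sigma> *\<^sub>R inner h (?f (x, - y)) + (1 - \<sigma>) *\<^sub>R inner h (?f (x, y)) \<partial>P)"
      by (rule flip)
    \<comment> \<open>\<open>?f\<close> is odd in the label, so the two weights combine to
      \<open>(1 - \<sigma>) - \<sigma>\<close>.\<close>
    also have "\<dots> = (\<integral>z. (1 - 2 * \<sigma>) * inner h (?f z) \<partial>P)"
      by (intro Bochner_Integration.integral_cong) (auto simp: algebra_simps)
    also have "\<dots> = inner h ((1 - 2 * \<sigma>) *\<^sub>R I)"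
      using has_bochner_integral_integral_eq[OF Ih] by simp
    finally show ?thesis .
  qed
  then have "J = (1 - 2 * \<sigma>) *\<^sub>R I"
    using vector_eq_ldot[of J "(1 - 2 * \<sigma>) *\<^sub>R I"] by blast
  then show ?thesis
    unfolding mean_vector_def strong_bochner_integral_eqI[OF I] strong_bochner_integral_eqI[OF J] .
qed

lemma zero_one_loss_scale:
  assumes "0 < c"
  shows "zero_one_loss y (c * v) = zero_one_loss y v"
proof -
  have "y * (c * v) \<le> 0 \<longleftrightarrow> y * v \<le> 0"
    using mult_le_cancel_left_pos[OF assms, of "y * v" 0] by (simp add: mult.left_commute)
  then show ?thesis by (simp add: zero_one_loss_def)
qed

theorem lemma10:
  fixes X :: "'x measure"
    and \<phi> :: "'x \<Rightarrow> 'h::{real_inner, banach}"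
    and P :: "('x \<times> real) measure"
    and \<sigma> :: real
  assumes "bounded_feature_map X \<phi>"
    and "prob_space P"
    and "sets P = sets (X \<Otimes>\<^sub>M labels)"
    and "0 \<le> \<sigma>" and "\<sigma> < 1 / 2"
  shows "zero_one_risk \<phi> P (mean_vector \<phi> P) =
         zero_one_risk \<phi> P (mean_vector \<phi> (flip_labels \<sigma> P))"
proof -
  have \<Phi>: "mean_vector \<phi> (flip_labels \<sigma> P) = (1 - 2 * \<sigma>) *\<^sub>R mean_vector \<phi> P"
    using assms by (intro mean_vector_flip_labels) auto
  \<comment> \<open>Strictness of \<open>\<sigma> < 1 / 2\<close> matters: at \<open>1 / 2\<close>
    the noisy mean vector would vanish and every loss would be 1.\<close>
  have "0 < 1 - 2 * \<sigma>" using assms(5) by simp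
  then show ?thesis
    by (simp only: zero_one_risk_def \<Phi> inner_scaleR_left zero_one_loss_scale)
qed

end
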